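(* Let $(G,\Gamma)$ be a periodic graph with a sofic group $\Gamma$. Assume that the vertex degree of $G$ is bounded by $D\in\mathbb N$ and that $F$ is a fundamental domain of finite co-volume. Then there exists a weakly convergent sequence of finite graphs $(G_n)$ such that for all $\alpha\in\mathcal A^D$ $$\lim_{n\to\infty}p(G_n,\alpha)=\frac{\sum_{f\in F_\alpha}1/|\Gamma_f|}{\sum_{f\in F}1/|\Gamma_f|},$$ where $F_\alpha=\{f\in F:B^G_{\rho(\alpha)}(f)\in\alpha\}$.
   Context: Graphs are undirected without loops or multiple edges and have uniformly bounded vertex degree. $B_r^G(x)$ is the induced graph on the ball of radius $r$ about $x$ in the combinatorial distance, rooted at $x$. The radius $\rho$ of a finite connected rooted graph is the maximal distance of a vertex from the root. $\mathcal A^D$ is the set of isomorphism classes of finite connected rooted graphs with vertex degrees at most $D$; $B_r^G(x)\in\alpha$ means that $B_r^G(x)$ represents $\alpha$. Periodic graph: a pair $(G,\Gamma)$ with $G=(V,E)$ a countably infinite connected graph and $\Gamma$ a countable subgroup of the automorphism group of $G$ such that (i) each stabilizer $\Gamma_x=\{\gamma\in\Gamma:\gamma x=x\}$, $x\in V$, is finite, and (ii) there is a set $F\subset V$ containing exactly one representative of each $\Gamma$-orbit in $V$ with $\sum_{f\in F}\frac1{|\Gamma_f|}<\infty$. Such $F$ (possibly infinite) is called a fundamental domain (of finite co-volume). Sofic group: a group $\Gamma$ with unit $e$ is sofic if for every finite $T\subseteq\Gamma$ and every $\varepsilon>0$ there are $n\in\mathbb N$ and a map $\sigma:T\to\mathrm{Sym}(n)$,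 $s\mapsto\sigma_s$, such that $d_H(\sigma_s\sigma_t,\sigma_{st})<\varepsilon$ whenever $s,t,st\in T$; $d_H(\sigma_e,\mathrm{Id}_n)<\varepsilon$ if $e\in T$; and $d_H(\sigma_s,\sigma_t)\ge1-\varepsilon$ for $s\ne t$ in $T$; here $d_H(\sigma,\tau)=\frac1n\#\{a\in\{1,\dots,n\}:\sigma(a)\ne\tau(a)\}$. For a finite graph $H=(V_H,E_H)$, $p(H,\alpha)=|\{x\in V_H:B^H_{\rho(\alpha)}(x)\in\alpha\}|/|V_H|$. A sequence $(G_n)$ of finite graphs with vertex degrees uniformly bounded by $D$ is weakly convergent if $\lim_np(G_n,\alpha)$ exists for every $\alpha\in\mathcal A^D$. *)

theory Defs
  imports
    "HOL-Algebra.Group_Action"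
    "HOL-Analysis.Infinite_Sum"
    "HOL-Combinatorics.Permutations"
    "HOL-Library.Extended_Nat"
begin

record 'v ugraph =
  verts :: "'v set"
  edges :: "'v set set"

definition simple_graph :: "'v ugraph \<Rightarrow> bool" where
  "simple_graph G \<longleftrightarrow> (\<forall>e\<in>edges G. e \<subseteq> verts G \<and> card e = 2)"

definition neighbours :: "'v ugraph \<Rightarrow> 'v \<Rightarrow> 'v set" where
  "neighbours G x = {y. {x, y} \<in> edges G}"

text \<open>Finiteness is explicit because \<^const>\<open>card\<close> is 0 on infinite sets.\<close>

definition degree_bounded :: "nat \<Rightarrow> 'v ugraph \<Rightarrow> bool" where
  "degree_bounded D G \<longleftrightarrow>
    (\<forall>x\<in>verts G. finite (neighbours G x) \<and> card (neighbours G x) \<le> D)"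

definition adj :: "'v ugraph \<Rightarrow> ('v \<times> 'v) set" where
  "adj G = {(x, y). {x, y} \<in> edges G}"

definition connected_graph :: "'v ugraph \<Rightarrow> bool" where
  "connected_graph G \<longleftrightarrow>
    verts G \<noteq> {} \<and> (\<forall>x\<in>verts G. \<forall>y\<in>verts G. (x, y) \<in> (adj G)\<^sup>*)"

text \<open>Vertices in different components have distance \<open>Inf {} = \<infinity>\<close>.\<close>

definition gdist :: "'v ugraph \<Rightarrow> 'v \<Rightarrow> 'v \<Rightarrow> enat" where
  "gdist G x y = (INF n\<in>{n. (x, y) \<in> adj G ^^ n}. enat n)"

definition induced_graph :: "'v ugraph \<Rightarrow> 'v set \<Rightarrow> 'v ugraph" where
  "induced_graph G S = \<lparr>verts = verts G \<inter> S, edges = {e \<in> edges G. e \<subseteq> S}\<rparr>"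

type_synonym 'v rooted_graph = "'v ugraph \<times> 'v"

definition gball :: "'v ugraph \<Rightarrow> nat \<Rightarrow> 'v \<Rightarrow> 'v rooted_graph" where
  "gball G r x = (induced_graph G {y \<in> verts G. gdist G x y \<le> enat r}, x)"

definition rooted_iso :: "'v rooted_graph \<Rightarrow> 'w rooted_graph \<Rightarrow> bool" where
  "rooted_iso R S \<longleftrightarrow> (\<exists>f. bij_betw f (verts (fst R)) (verts (fst S))
    \<and> (\<forall>x\<in>verts (fst R). \<forall>y\<in>verts (fst R).
          {f x, f y} \<in> edges (fst S) \<longleftrightarrow> {x, y} \<in> edges (fst R))
    \<and> f (snd R) = snd S)"

text \<open>Meaningful for finite connected rooted graphs only.\<close>

definition radius :: "'v rooted_graph \<Rightarrow> nat" where
  "radius R = Max ((\<lambda>y. the_enat (gdist (fst R) (snd R) y)) ` verts (fst R))"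

text \<open>Every finite graph has an isomorphic copy on a set of natural numbers, so the
  isomorphism classes are taken among graphs with vertices of type \<^typ>\<open>nat\<close>.
  \<open>represents\<close> compares these classes with rooted graphs over an arbitrary vertex type.\<close>

definition fc_rooted_graphs :: "nat \<Rightarrow> nat rooted_graph set" where
  "fc_rooted_graphs D = {(H, z). simple_graph H \<and> finite (verts H) \<and> connected_graph H
    \<and> degree_bounded D H \<and> z \<in> verts H}"

definition iso_classes :: "nat \<Rightarrow> nat rooted_graph set set" where
  "iso_classes D = fc_rooted_graphs D //
    {(R, S). R \<in> fc_rooted_graphs D \<and> S \<in> fc_rooted_graphs D \<and> rooted_iso R S}"

definition represents :: "'v rooted_graph \<Rightarrow> nat rooted_graph set \<Rightarrow> bool" where
  "represents R \<alpha> \<longleftrightarrow> (\<exists>S\<in>\<alpha>. rooted_iso R S)"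

text \<open>The common radius of all members of a class.\<close>

definition class_radius :: "nat rooted_graph set \<Rightarrow> nat" where
  "class_radius \<alpha> = the_elem (radius ` \<alpha>)"

definition finite_graph :: "'v ugraph \<Rightarrow> bool" where
  "finite_graph H \<longleftrightarrow> simple_graph H \<and> finite (verts H) \<and> verts H \<noteq> {}"

definition frequency :: "'v ugraph \<Rightarrow> nat rooted_graph set \<Rightarrow> real" where
  "frequency H \<alpha> =
    real (card {x \<in> verts H. represents (gball H (class_radius \<alpha>) x) \<alpha>})
      / real (card (verts H))"

definition weakly_convergent :: "nat \<Rightarrow> (nat \<Rightarrow> 'v ugraph) \<Rightarrow> bool" where
  "weakly_convergent D H \<longleftrightarrow> (\<forall>n. finite_graph (H n) \<and> degree_bounded D (H n))
    \<and> (\<forall>\<alpha>\<in>iso_classes D. convergent (\<lambda>n. frequency (H n) \<alpha>))"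

definition hamming_dist :: "nat \<Rightarrow> (nat \<Rightarrow> nat) \<Rightarrow> (nat \<Rightarrow> nat) \<Rightarrow> real" where
  "hamming_dist n p q = real (card {a \<in> {1..n}. p a \<noteq> q a}) / real n"

definition sofic :: "('a, 'b) monoid_scheme \<Rightarrow> bool" where
  "sofic K \<longleftrightarrow> group K \<and>
    (\<forall>T \<epsilon>. finite T \<and> T \<subseteq> carrier K \<and> \<epsilon> > 0 \<longrightarrow>
      (\<exists>n \<sigma>. n \<ge> 1 \<and> (\<forall>s\<in>T. \<sigma> s permutes {1..n})
        \<and> (\<forall>s\<in>T. \<forall>t\<in>T. s \<otimes>\<^bsub>K\<^esub> t \<in> T \<longrightarrow>
              hamming_dist n (\<sigma> s \<circ> \<sigma> t) (\<sigma> (s \<otimes>\<^bsub>K\<^esub> t)) < \<epsilon>)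
        \<and> (\<one>\<^bsub>K\<^esub> \<in> T \<longrightarrow> hamming_dist n (\<sigma> \<one>\<^bsub>K\<^esub>) id < \<epsilon>)
        \<and> (\<forall>s\<in>T. \<forall>t\<in>T. s \<noteq> t \<longrightarrow> hamming_dist n (\<sigma> s) (\<sigma> t) \<ge> 1 - \<epsilon>)))"

definition aut_group :: "'v ugraph \<Rightarrow> ('v \<Rightarrow> 'v) monoid" where
  "aut_group G = BijGroup (verts G)\<lparr>carrier :=
    {f \<in> Bij (verts G). \<forall>x\<in>verts G. \<forall>y\<in>verts G.
      {f x, f y} \<in> edges G \<longleftrightarrow> {x, y} \<in> edges G}\<rparr>"

text \<open>A subgroup \<open>\<Gamma>\<close> of the automorphism group as a group in its own right; it acts on
  the vertices by application.\<close>

abbreviation sub_aut_group :: "'v ugraph \<Rightarrow> ('v \<Rightarrow> 'v) set \<Rightarrow> ('v \<Rightarrow> 'v) monoid" where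
  "sub_aut_group G \<Gamma> \<equiv> aut_group G\<lparr>carrier := \<Gamma>\<rparr>"

abbreviation stab :: "'v ugraph \<Rightarrow> ('v \<Rightarrow> 'v) set \<Rightarrow> 'v \<Rightarrow> ('v \<Rightarrow> 'v) set" where
  "stab G \<Gamma> x \<equiv> stabilizer (sub_aut_group G \<Gamma>) (\<lambda>\<gamma>. \<gamma>) x"

definition fundamental_domain :: "'v ugraph \<Rightarrow> ('v \<Rightarrow> 'v) set \<Rightarrow> 'v set \<Rightarrow> bool" where
  "fundamental_domain G \<Gamma> F \<longleftrightarrow> F \<subseteq> verts G
    \<and> (\<forall>X\<in>orbits (sub_aut_group G \<Gamma>) (verts G) (\<lambda>\<gamma>. \<gamma>). \<exists>!f. f \<in> F \<inter> X)
    \<and> (\<lambda>f. 1 / real (card (stab G \<Gamma> f))) summable_on F"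

definition periodic_graph :: "'v ugraph \<Rightarrow> ('v \<Rightarrow> 'v) set \<Rightarrow> bool" where
  "periodic_graph G \<Gamma> \<longleftrightarrow>
    simple_graph G \<and> connected_graph G \<and> (\<exists>D. degree_bounded D G)
    \<and> countable (verts G) \<and> infinite (verts G)
    \<and> subgroup \<Gamma> (aut_group G) \<and> countable \<Gamma>
    \<and> (\<forall>x\<in>verts G. finite (stab G \<Gamma> x))
    \<and> (\<exists>F. fundamental_domain G \<Gamma> F)"

end

theory Submission
  imports Defs
begin

text \<open>
If \<open>\<Gamma>\<close> were residually finite, one would take a finite quotient \<open>X\<close> of \<open>\<Gamma>\<close> and use the quotient
\<open>(X \<times> V) / \<Gamma>\<close> of the graph: once \<open>X\<close> separates enough of \<open>\<Gamma>\<close>, there are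
\<open>|X| / |\<Gamma>\<^sub>f|\<close> vertices over a given \<open>f \<in> F\<close>, with the same balls as \<open>f\<close> in \<open>G\<close>.
A sofic approximation \<open>\<sigma>\<close> on \<open>{1..n}\<close> replaces the action on \<open>X\<close>. It is multiplicative and free only near most points \<open>a\<close>, and only for a prescribed finite part
\<open>S\<close> of \<open>\<Gamma>\<close>, so the quotient is built from the set \<open>A\<close> of these good points alone
(\<open>sofic_good_points\<close>).

The class of \<open>(a, v)\<close> is represented by its intersection with \<open>{1..n} \<times> F\<close>, the cell
\<open>{(\<sigma>\<^sub>\<gamma> a, \<gamma> v) | \<gamma> v \<in> F}\<close>. For a good point \<open>a\<close>, the map \<open>v \<mapsto> cell a v\<close> is a chart of the finite graph,
defined on a finite piece \<open>W\<close> of \<open>G\<close>; two vertices of the finite graph are adjacent when they are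
adjacent in some chart. The decisive fact is that two charts whose cells meet differ by the action of
an element of \<open>\<Gamma>\<close> (\<open>cell_meet\<close>). It follows that a chart carries balls contained in \<open>W\<close> isomorphically
onto balls of the finite graph (\<open>gball_patch_graph\<close>), that degrees do not increase, and that distinct
cells are disjoint.

The cells over \<open>f\<close> have exactly \<open>|\<Gamma>\<^sub>f|\<close> elements. Giving every point of \<open>{1..n} \<times> {f}\<close> the weight
\<open>1 / |\<Gamma>\<^sub>f|\<close> therefore turns numbers of vertices into weights of subsets of \<open>{1..n} \<times> F\<close>
(\<open>card_cells_eq_weight\<close>). So the finite graph has at most \<open>n * (\<Sum>f\<in>F. 1 / |\<Gamma>\<^sub>f|)\<close> vertices, and, since
the cells \<open>cell a f\<close> with \<open>a \<in> A\<close> cover \<open>A \<times> {f}\<close>, almost \<open>n / |\<Gamma>\<^sub>f|\<close> vertices over each \<open>f\<close> in a large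
finite part of \<open>F\<close> have the same balls as \<open>f\<close>. The lower bounds for the vertices whose ball represents
\<open>\<alpha>\<close> and for those whose ball does not, together with the upper bound for all vertices, determine
the frequency of \<open>\<alpha>\<close> in the limit.
\<close>

section \<open>Distances, balls and rooted isomorphisms\<close>

lemma gdist_le_iff: "gdist G x y \<le> enat r \<longleftrightarrow> (\<exists>m\<le>r. (x, y) \<in> adj G ^^ m)"
proof
  let ?N = "{n. (x, y) \<in> adj G ^^ n}"
  assume le: "gdist G x y \<le> enat r"
  have "?N \<noteq> {}"
  proof
    assume "?N = {}"
    then have "gdist G x y = \<infinity>"
      by (simp add: gdist_def top_enat_def)
    with le show False by simp
  qed
  then have "gdist G x y \<in> enat ` ?N"
    unfolding gdist_def by (metis empty_iff equals0I image_eqI wellorder_InfI)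
  with le show "\<exists>m\<le>r. (x, y) \<in> adj G ^^ m" by auto
next
  assume "\<exists>m\<le>r. (x, y) \<in> adj G ^^ m"
  then obtain m where "m \<le> r" "(x, y) \<in> adj G ^^ m" by blast
  then have "gdist G x y \<le> enat m"
    unfolding gdist_def by (intro INF_lower) simp
  with \<open>m \<le> r\<close> show "gdist G x y \<le> enat r"
    by (meson enat_ord_simps(1) order_trans)
qed

lemma simple_graph_edge_in_verts:
  "simple_graph G \<Longrightarrow> {x, y} \<in> edges G \<Longrightarrow> x \<in> verts G \<and> y \<in> verts G"
  by (auto simp: simple_graph_def)

lemma walk_end_in_verts:
  assumes "simple_graph G" "x \<in> verts G" "(x, y) \<in> adj G ^^ m"
  shows "y \<in> verts G"
  using assms
  by (cases m) (auto simp: adj_def dest: simple_graph_edge_in_verts)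

lemma finite_distance_ball:
  assumes "simple_graph G" "degree_bounded D G" "x \<in> verts G"
  shows "finite {y \<in> verts G. gdist G x y \<le> enat r}"
proof -
  have fin: "finite {y. (x, y) \<in> adj G ^^ m}" for m
  proof (induction m)
    case (Suc m)
    have "{z. (x, z) \<in> adj G ^^ Suc m} \<subseteq> (\<Union>y\<in>{y. (x, y) \<in> adj G ^^ m}. neighbours G y)"
      by (auto simp: adj_def neighbours_def)
    moreover have "finite (neighbours G y)" if "(x, y) \<in> adj G ^^ m" for y
      using walk_end_in_verts[OF assms(1,3) that] assms(2) by (simp add: degree_bounded_def)
    ultimately show ?case
      by (elim finite_subset) (use Suc in auto)
  qed simp
  have "{y \<in> verts G. gdist G x y \<le> enat r} \<subseteq> (\<Union>m\<le>r. {y. (x, y) \<in> adj G ^^ m})"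
    by (auto simp: gdist_le_iff)
  then show ?thesis
    by (rule finite_subset) (use fin in auto)
qed

lemma rooted_iso_sym:
  assumes "snd R \<in> verts (fst R)" "rooted_iso R S"
  shows "rooted_iso S R"
proof -
  obtain f where f: "bij_betw f (verts (fst R)) (verts (fst S))" "f (snd R) = snd S"
    and e: "\<forall>x\<in>verts (fst R). \<forall>y\<in>verts (fst R).
          {f x, f y} \<in> edges (fst S) \<longleftrightarrow> {x, y} \<in> edges (fst R)"
    using assms(2) unfolding rooted_iso_def by blast
  let ?g = "inv_into (verts (fst R)) f"
  have g: "bij_betw ?g (verts (fst S)) (verts (fst R))"
    using f(1) by (rule bij_betw_inv_into)
  have "{?g x, ?g y} \<in> edges (fst R) \<longleftrightarrow> {x, y} \<in> edges (fst S)"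
    if "x \<in> verts (fst S)" "y \<in> verts (fst S)" for x y
    using e that bij_betwE[OF g] bij_betw_inv_into_right[OF f(1)] by metis
  moreover have "?g (snd S) = snd R"
    using f assms(1) bij_betw_inv_into_left by metis
  ultimately show ?thesis
    using g unfolding rooted_iso_def by blast
qed

lemma rooted_iso_trans:
  assumes "rooted_iso R S" "rooted_iso S T"
  shows "rooted_iso R T"
proof -
  obtain f where f: "bij_betw f (verts (fst R)) (verts (fst S))" "f (snd R) = snd S"
    and fe: "\<forall>x\<in>verts (fst R). \<forall>y\<in>verts (fst R).
          {f x, f y} \<in> edges (fst S) \<longleftrightarrow> {x, y} \<in> edges (fst R)"
    using assms(1) unfolding rooted_iso_def by blast
  obtain g where g: "bij_betw g (verts (fst S)) (verts (fst T))" "g (snd S) = snd T"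
    and ge: "\<forall>x\<in>verts (fst S). \<forall>y\<in>verts (fst S).
          {g x, g y} \<in> edges (fst T) \<longleftrightarrow> {x, y} \<in> edges (fst S)"
    using assms(2) unfolding rooted_iso_def by blast
  have "bij_betw (g \<circ> f) (verts (fst R)) (verts (fst T))"
    using f(1) g(1) by (rule bij_betw_trans)
  moreover have "{(g \<circ> f) x, (g \<circ> f) y} \<in> edges (fst T) \<longleftrightarrow> {x, y} \<in> edges (fst R)"
    if "x \<in> verts (fst R)" "y \<in> verts (fst R)" for x y
    using fe ge that bij_betwE[OF f(1)] by simp
  ultimately show ?thesis
    unfolding rooted_iso_def by (intro exI[of _ "g \<circ> f"]) (use f(2) g(2) in auto)
qed

lemma represents_cong:
  assumes "snd R \<in> verts (fst R)" "rooted_iso R S"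
  shows "represents R \<alpha> \<longleftrightarrow> represents S \<alpha>"
  using assms rooted_iso_sym rooted_iso_trans unfolding represents_def by meson

section \<open>Graphs glued from charts\<close>

text \<open>Each \<open>a \<in> A\<close> is a chart \<open>k a\<close> from the finite piece \<open>W\<close> of \<open>G\<close> into a new graph, which is the
  union of the images of the subgraph induced on \<open>W\<close>.\<close>
definition patch_graph :: "'v ugraph \<Rightarrow> 'v set \<Rightarrow> 'a set \<Rightarrow> ('a \<Rightarrow> 'v \<Rightarrow> 'w) \<Rightarrow> 'w ugraph" where
  "patch_graph G W A k =
    \<lparr>verts = {k a v | a v. a \<in> A \<and> v \<in> W},
     edges = {{k a v, k a w} | a v w. a \<in> A \<and> v \<in> W \<and> w \<in> W \<and> {v, w} \<in> edges G}\<rparr>"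

text \<open>Injectivity is demanded one step beyond \<open>W\<close> because changing the chart may move a neighbour
  of a vertex of \<open>W\<close> out of \<open>W\<close>. The last assumption says that all edges at a glued vertex are
  visible from each chart through that vertex; it makes every chart a local covering.\<close>
locale compatible_charts =
  fixes G :: "'v ugraph" and W :: "'v set" and A :: "'a set" and k :: "'a \<Rightarrow> 'v \<Rightarrow> 'w"
  assumes simple: "simple_graph G"
    and W_verts: "W \<subseteq> verts G"
    and inj: "a \<in> A \<Longrightarrow> inj_on (k a) (W \<union> (\<Union>v\<in>W. neighbours G v))"
    and change_chart: "\<lbrakk>a \<in> A; a' \<in> A; v \<in> W; v' \<in> W; w' \<in> W; k a v = k a' v';
      {v', w'} \<in> edges G\<rbrakk> \<Longrightarrow> \<exists>w. {v, w} \<in> edges G \<and> k a' w' = k a w"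
begin

abbreviation "H \<equiv> patch_graph G W A k"

lemma edge_lift:
  assumes "a \<in> A" "v \<in> W" "{k a v, y} \<in> edges H"
  shows "\<exists>w. {v, w} \<in> edges G \<and> y = k a w"
proof -
  obtain a' v' w' where *: "{k a v, y} = {k a' v', k a' w'}" "a' \<in> A" "v' \<in> W" "w' \<in> W"
      "{v', w'} \<in> edges G"
    using assms(3) by (auto simp: patch_graph_def)
  then consider "k a v = k a' v'" "y = k a' w'" | "k a v = k a' w'" "y = k a' v'"
    by (auto simp: doubleton_eq_iff)
  then show ?thesis
  proof cases
    case 1 then show ?thesis using change_chart[of a a' v v' w'] * assms by auto
  next
    case 2
    then show ?thesis using change_chart[of a a' v w' v'] * assms by (auto simp: insert_commute)
  qed
qed

lemma edge_push:
  "a \<in> A \<Longrightarrow> v \<in> W \<Longrightarrow> w \<in> W \<Longrightarrow> {v, w} \<in> edges G \<Longrightarrow> {k a v, k a w} \<in> edges H"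
  by (auto simp: patch_graph_def)

lemma simple_patch_graph: "simple_graph H"
proof -
  have "card {k a v, k a w} = 2" if "a \<in> A" "v \<in> W" "w \<in> W" "{v, w} \<in> edges G" for a v w
  proof -
    have "v \<noteq> w" using that simple by (auto simp: simple_graph_def)
    then have "k a v \<noteq> k a w" using inj[OF that(1)] that by (auto simp: inj_on_def)
    then show ?thesis by simp
  qed
  then show ?thesis
    by (auto simp: simple_graph_def patch_graph_def)
qed

text \<open>By edge lifting, all neighbours of a vertex come from the neighbours of one of its preimages.\<close>
lemma degree_bounded_patch_graph:
  assumes "degree_bounded D G"
  shows "degree_bounded D H"
  unfolding degree_bounded_def
proof
  fix x assume "x \<in> verts H"
  then obtain a v where av: "x = k a v" "a \<in> A" "v \<in> W"
    by (auto simp: patch_graph_def)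
  have sub: "neighbours H x \<subseteq> k a ` neighbours G v"
    using edge_lift[OF av(2,3)] by (auto simp: neighbours_def av(1))
  have fin: "finite (neighbours G v)" "card (neighbours G v) \<le> D"
    using assms av W_verts by (auto simp: degree_bounded_def)
  then show "finite (neighbours H x) \<and> card (neighbours H x) \<le> D"
    using sub by (meson card_image_le card_mono finite_imageI finite_subset order_trans)
qed

text \<open>The walk stays in the ball before its last step, hence in \<open>W\<close>, where edges can be lifted.\<close>
lemma walk_lift:
  assumes "a \<in> A" and ball: "{y \<in> verts G. gdist G v y \<le> enat r} \<subseteq> W" and "v \<in> verts G"
    and "m \<le> r" "(k a v, y) \<in> adj H ^^ m"
  shows "\<exists>w. (v, w) \<in> adj G ^^ m \<and> y = k a w"
  using assms(4,5)
proof (induction m arbitrary: y)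
  case (Suc m)
  then obtain z where z: "(k a v, z) \<in> adj H ^^ m" "{z, y} \<in> edges H"
    by (auto simp: adj_def)
  obtain w where w: "(v, w) \<in> adj G ^^ m" "z = k a w"
    using Suc.IH[of z] Suc.prems(1) z(1) by auto
  have "w \<in> verts G" using walk_end_in_verts[OF simple assms(3) w(1)] .
  moreover have "gdist G v w \<le> enat r"
    using w(1) Suc.prems(1) by (auto simp: gdist_le_iff intro!: exI[of _ m])
  ultimately have "w \<in> W" using ball by auto
  then obtain u where "{w, u} \<in> edges G" "y = k a u"
    using edge_lift[OF assms(1)] z(2) w(2) by blast
  then show ?case using w(1) by (auto simp: adj_def)
qed auto

lemma walk_push:
  assumes "a \<in> A" and ball: "{y \<in> verts G. gdist G v y \<le> enat r} \<subseteq> W" and "v \<in> verts G"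
    and "m \<le> r" "(v, w) \<in> adj G ^^ m"
  shows "(k a v, k a w) \<in> adj H ^^ m"
  using assms(4,5)
proof (induction m arbitrary: w)
  case (Suc m)
  then obtain z where z: "(v, z) \<in> adj G ^^ m" "{z, w} \<in> edges G"
    by (auto simp: adj_def)
  have "z \<in> W"
    using ball walk_end_in_verts[OF simple assms(3) z(1)] z(1) Suc.prems(1)
    by (auto simp: gdist_le_iff intro!: exI[of _ m])
  moreover have "w \<in> W"
    using ball walk_end_in_verts[OF simple assms(3) Suc.prems(2)] Suc.prems
    unfolding gdist_le_iff by blast
  ultimately have "(k a z, k a w) \<in> adj H"
    using edge_push[OF assms(1)] z(2) by (simp add: adj_def)
  then show ?case
    using Suc.IH[of z] Suc.prems(1) z(1) by auto
qed auto

text \<open>Pushing and lifting walks identifies the vertices of the two balls. A chart is injective on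
  \<open>W\<close> and its neighbours, so the lift of an edge between two vertices of the ball ends at the right
  vertex and no new edges appear.\<close>
lemma gball_patch_graph:
  assumes "a \<in> A" and ball: "{y \<in> verts G. gdist G v y \<le> enat r} \<subseteq> W" and "v \<in> verts G"
  shows "rooted_iso (gball G r v) (gball H r (k a v))"
proof -
  define B where "B = {y \<in> verts G. gdist G v y \<le> enat r}"
  have BW: "B \<subseteq> W" using ball by (simp add: B_def)
  have image: "k a ` B = {y \<in> verts H. gdist H (k a v) y \<le> enat r}"
  proof (intro equalityI subsetI)
    fix y assume "y \<in> k a ` B"
    then obtain w where w: "w \<in> B" "y = k a w" by blast
    then have "y \<in> verts H" using BW assms(1) by (auto simp: patch_graph_def)
    moreover have "gdist H (k a v) y \<le> enat r"
      using w walk_push[OF assms] by (auto simp: B_def gdist_le_iff)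
    ultimately show "y \<in> {y \<in> verts H. gdist H (k a v) y \<le> enat r}" by simp
  next
    fix y assume "y \<in> {y \<in> verts H. gdist H (k a v) y \<le> enat r}"
    then obtain m where "m \<le> r" "(k a v, y) \<in> adj H ^^ m" by (auto simp: gdist_le_iff)
    then obtain w where w: "(v, w) \<in> adj G ^^ m" "y = k a w"
      using walk_lift[OF assms] by blast
    then have "w \<in> B"
      using walk_end_in_verts[OF simple assms(3)] \<open>m \<le> r\<close> by (auto simp: B_def gdist_le_iff)
    with w show "y \<in> k a ` B" by simp
  qed
  have "bij_betw (k a) B (k a ` B)"
    using inj[OF assms(1)] BW by (meson inj_on_imp_bij_betw inj_on_subset le_supI1)
  moreover have "{k a x, k a y} \<in> edges H \<longleftrightarrow> {x, y} \<in> edges G" if xy: "x \<in> B" "y \<in> B" for x y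
  proof
    assume "{k a x, k a y} \<in> edges H"
    then obtain w where w: "{x, w} \<in> edges G" "k a y = k a w"
      using edge_lift[OF assms(1)] xy BW by blast
    then have "w \<in> neighbours G x" by (simp add: neighbours_def)
    then have "y = w"
      using inj[OF assms(1)] w(2) that BW by (auto simp: inj_on_def)
    then show "{x, y} \<in> edges G" using w by simp
  next
    assume "{x, y} \<in> edges G"
    then show "{k a x, k a y} \<in> edges H" using edge_push[OF assms(1)] that BW by auto
  qed
  moreover have "verts (fst (gball G r v)) = B"
    by (auto simp: gball_def induced_graph_def B_def)
  moreover have "verts (fst (gball H r (k a v))) = k a ` B"
    unfolding image by (auto simp: gball_def induced_graph_def)
  moreover have "{x, y} \<in> edges (fst (gball G r v)) \<longleftrightarrow> {x, y} \<in> edges G"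
    if "x \<in> B" "y \<in> B" for x y
    using that by (auto simp: gball_def induced_graph_def B_def)
  moreover have "{x, y} \<in> edges (fst (gball H r (k a v))) \<longleftrightarrow> {x, y} \<in> edges H"
    if "x \<in> k a ` B" "y \<in> k a ` B" for x y
    using that unfolding image by (auto simp: gball_def induced_graph_def)
  ultimately show ?thesis
    unfolding rooted_iso_def
    by (intro exI[of _ "k a"]) (simp add: gball_def)
qed

lemma represents_gball_patch_graph:
  assumes "a \<in> A" and "{y \<in> verts G. gdist G v y \<le> enat r} \<subseteq> W" and "v \<in> verts G"
  shows "represents (gball H r (k a v)) \<alpha> \<longleftrightarrow> represents (gball G r v) \<alpha>"
proof -
  have "gdist G v v \<le> enat r"
    by (auto simp: gdist_le_iff intro!: exI[of _ 0])
  then have "snd (gball G r v) \<in> verts (fst (gball G r v))"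
    using assms(3) by (simp add: gball_def induced_graph_def)
  then show ?thesis
    using represents_cong gball_patch_graph[OF assms] by blast
qed

end

section \<open>Good points of a sofic approximation\<close>

text \<open>Each of the finitely many conditions in the conclusion fails at a fraction of at most
  \<open>\<delta>\<close> of the points. For a fixed pair \<open>(s, t)\<close> there are two of them, one for the product and one for
  freeness, so the exceptional set has relative size at most \<open>2 * |S \<times> S| * \<delta>\<close>.\<close>
lemma sofic_good_points:
  fixes K (structure)
  assumes "sofic K" "finite S" "S \<subseteq> carrier K" "\<epsilon> > 0"
  shows "\<exists>n \<sigma> A. n \<ge> 1 \<and> (\<forall>s\<in>S. \<sigma> s permutes {1..n}) \<and> A \<subseteq> {1..n} \<and>
    real (card A) \<ge> (1 - \<epsilon>) * real n \<and>
    (\<forall>a\<in>A. \<forall>s\<in>S. \<forall>t\<in>S. \<sigma> s (\<sigma> t a) = \<sigma> (s \<otimes> t) a) \<and>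
    (\<forall>a\<in>A. inj_on (\<lambda>s. \<sigma> s a) S)"
proof -
  interpret group K using assms(1) by (simp add: sofic_def)
  define T where "T = S \<union> (\<lambda>(s, t). s \<otimes> t) ` (S \<times> S)"
  define \<delta> where "\<delta> = \<epsilon> / (2 * real (card (S \<times> S)) + 1)"
  have "\<delta> > 0" using assms(4) by (simp add: \<delta>_def add_nonneg_pos)
  have "finite T \<and> T \<subseteq> carrier K \<and> \<delta> > 0"
    using assms(2,3) \<open>\<delta> > 0\<close> by (auto simp: T_def)
  from assms(1)[unfolded sofic_def, THEN conjunct2, rule_format, OF this] obtain n \<sigma> where n: "n \<ge> 1" and perm: "\<forall>s\<in>T. \<sigma> s permutes {1..n}"
    and mult: "\<forall>s\<in>T. \<forall>t\<in>T. s \<otimes> t \<in> T \<longrightarrow> hamming_dist n (\<sigma> s \<circ> \<sigma> t) (\<sigma> (s \<otimes> t)) < \<delta>"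
    and free: "\<forall>s\<in>T. \<forall>t\<in>T. s \<noteq> t \<longrightarrow> hamming_dist n (\<sigma> s) (\<sigma> t) \<ge> 1 - \<delta>"
    by (elim exE conjE) (rule that)
  \<comment> \<open>\<open>M\<close> collects the failures of multiplicativity and \<open>E\<close> those of freeness.\<close>
  define M where "M s t = {a \<in> {1..n}. \<sigma> s (\<sigma> t a) \<noteq> \<sigma> (s \<otimes> t) a}" for s t
  define E where "E s t = (if s = t then {} else {a \<in> {1..n}. \<sigma> s a = \<sigma> t a})" for s t
  have cM: "real (card (M s t)) \<le> \<delta> * n" if "s \<in> S" "t \<in> S" for s t
  proof -
    have "hamming_dist n (\<sigma> s \<circ> \<sigma> t) (\<sigma> (s \<otimes> t)) < \<delta>"
      using mult that by (force simp: T_def)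
    then show ?thesis
      using n by (simp add: hamming_dist_def M_def field_simps)
  qed
  have cE: "real (card (E s t)) \<le> \<delta> * n" if "s \<in> S" "t \<in> S" for s t
  proof (cases "s = t")
    case False
    have "{a \<in> {1..n}. \<sigma> s a \<noteq> \<sigma> t a} = {1..n} - E s t"
      using False by (auto simp: E_def)
    moreover have "E s t \<subseteq> {1..n}" by (auto simp: E_def)
    ultimately have "real (card {a \<in> {1..n}. \<sigma> s a \<noteq> \<sigma> t a}) = real n - real (card (E s t))"
      by (simp add: card_Diff_subset finite_subset of_nat_diff card_mono[of "{1..n}", simplified])
    moreover have "hamming_dist n (\<sigma> s) (\<sigma> t) \<ge> 1 - \<delta>"
      using free that False by (auto simp: T_def)
    ultimately show ?thesis
      using n by (simp add: hamming_dist_def field_simps)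
  qed (use \<open>\<delta> > 0\<close> in \<open>simp add: E_def\<close>)
  define B where "B = (\<Union>(s, t)\<in>S \<times> S. M s t \<union> E s t)"
  have B: "B \<subseteq> {1..n}" by (auto simp: B_def M_def E_def split: if_splits)
  have "real (card B) \<le> (\<Sum>(s, t)\<in>S \<times> S. real (card (M s t \<union> E s t)))"
    using card_UN_le[of "S \<times> S" "\<lambda>(s, t). M s t \<union> E s t"] assms(2)
    unfolding B_def by (simp add: case_prod_unfold flip: of_nat_sum)
  also have "\<dots> \<le> (\<Sum>(s, t)\<in>S \<times> S. 2 * \<delta> * n)"
  proof (intro sum_mono, clarify)
    fix s t assume "s \<in> S" "t \<in> S"
    have "real (card (M s t \<union> E s t)) \<le> real (card (M s t)) + real (card (E s t))"
      using card_Un_le by (simp flip: of_nat_add)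
    then show "real (card (M s t \<union> E s t)) \<le> 2 * \<delta> * n"
      using cM[OF \<open>s \<in> S\<close> \<open>t \<in> S\<close>] cE[OF \<open>s \<in> S\<close> \<open>t \<in> S\<close>] by linarith
  qed
  also have "\<dots> = (2 * real (card (S \<times> S)) * \<delta>) * n"
    by (simp add: case_prod_unfold)
  also have "\<dots> \<le> \<epsilon> * n"
  proof (rule mult_right_mono)
    have "2 * real (card (S \<times> S)) * \<delta> \<le> (2 * real (card (S \<times> S)) + 1) * \<delta>"
      using \<open>\<delta> > 0\<close> by (intro mult_right_mono) auto
    also have "\<dots> = \<epsilon>"
      by (simp add: \<delta>_def add_nonneg_pos less_imp_neq[symmetric] del: card_cartesian_product)
    finally show "2 * real (card (S \<times> S)) * \<delta> \<le> \<epsilon>" .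
  qed simp
  finally have "real (card B) \<le> \<epsilon> * n" .
  moreover have "real (card ({1..n} - B)) = real n - real (card B)"
    using B by (simp add: card_Diff_subset finite_subset of_nat_diff card_mono[of "{1..n}", simplified])
  ultimately have "real (card ({1..n} - B)) \<ge> (1 - \<epsilon>) * n"
    by (simp add: algebra_simps)
  moreover have "\<sigma> s (\<sigma> t a) = \<sigma> (s \<otimes> t) a" if "a \<in> {1..n} - B" "s \<in> S" "t \<in> S" for a s t
    using that by (auto simp: B_def M_def)
  moreover have "inj_on (\<lambda>s. \<sigma> s a) S" if "a \<in> {1..n} - B" for a
  proof (rule inj_onI, rule ccontr)
    fix s t assume st: "s \<in> S" "t \<in> S" "\<sigma> s a = \<sigma> t a" "s \<noteq> t"
    then have "a \<in> E s t" using that by (simp add: E_def)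
    then show False using st that by (auto simp: B_def)
  qed
  ultimately show ?thesis
    using n perm by (intro exI[of _ n] exI[of _ \<sigma>] exI[of _ "{1..n} - B"]) (auto simp: T_def)
qed

section \<open>Cells\<close>

text \<open>The set \<open>C\<close> is the part of \<open>V\<close> in which the construction takes place; it contains the
  representatives in \<open>F\<close> of its elements. \<open>S\<close> is the set of group elements that move some point of
  \<open>C\<close> within \<open>C\<close>. Only these have to be approximated well, and only at the points of \<open>A\<close>.\<close>
locale quotient_cells = group_action K V \<phi> for K (structure) and V :: "'v set" and \<phi> +
  fixes F C :: "'v set" and S and \<sigma> :: "_ \<Rightarrow> nat \<Rightarrow> nat" and n :: nat and A :: "nat set"
  defines "S \<equiv> {\<gamma> \<in> carrier K. \<exists>u\<in>C. \<phi> \<gamma> u \<in> C}"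
  assumes F_V: "F \<subseteq> V"
    and unique_rep: "v \<in> V \<Longrightarrow> \<exists>!f. f \<in> F \<inter> orbit K \<phi> v"
    and C_V: "C \<subseteq> V"
    and C_reps: "u \<in> C \<Longrightarrow> \<gamma> \<in> carrier K \<Longrightarrow> \<phi> \<gamma> u \<in> F \<Longrightarrow> \<phi> \<gamma> u \<in> C"
    and A_n: "A \<subseteq> {1..n}"
    and perm: "s \<in> S \<Longrightarrow> \<sigma> s permutes {1..n}"
    and mult: "a \<in> A \<Longrightarrow> s \<in> S \<Longrightarrow> t \<in> S \<Longrightarrow> \<sigma> s (\<sigma> t a) = \<sigma> (s \<otimes> t) a"
    and free: "a \<in> A \<Longrightarrow> inj_on (\<lambda>s. \<sigma> s a) S"
begin

sublocale group K
  using group_hom by (rule group_hom.axioms)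

text \<open>This is the orbit of \<open>(a, v)\<close> under the diagonal action of \<open>K\<close> on \<open>{1..n} \<times> V\<close>, cut down to
  \<open>{1..n} \<times> F\<close>, as it would be if \<open>\<sigma>\<close> were an action.\<close>
definition cell :: "nat \<Rightarrow> 'v \<Rightarrow> (nat \<times> 'v) set" where
  "cell a v = {(\<sigma> \<gamma> a, \<phi> \<gamma> v) | \<gamma>. \<gamma> \<in> carrier K \<and> \<phi> \<gamma> v \<in> F}"

lemma SI: "\<gamma> \<in> carrier K \<Longrightarrow> u \<in> C \<Longrightarrow> \<phi> \<gamma> u \<in> C \<Longrightarrow> \<gamma> \<in> S"
  by (auto simp: S_def)

lemma S_to_rep: "\<gamma> \<in> carrier K \<Longrightarrow> u \<in> C \<Longrightarrow> \<phi> \<gamma> u \<in> F \<Longrightarrow> \<gamma> \<in> S"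
  using SI C_reps by blast

lemma S_inv:
  assumes "s \<in> S" shows "inv s \<in> S"
proof -
  obtain u where u: "u \<in> C" "\<phi> s u \<in> C" and s: "s \<in> carrier K"
    using assms by (auto simp: S_def)
  moreover have "\<phi> (inv s) (\<phi> s u) = u"
    using orbit_sym_aux s u C_V by blast
  ultimately show ?thesis by (intro SI[of _ "\<phi> s u"]) auto
qed

lemma \<phi>_one: "v \<in> V \<Longrightarrow> \<phi> \<one> v = v"
  using id_eq_one by (metis restrict_apply')

text \<open>Multiplicativity makes the permutation \<open>\<sigma> \<one>\<close> fix its own value at \<open>a\<close>, hence \<open>a\<close>.\<close>
lemma \<sigma>_one:
  assumes "a \<in> A" "C \<noteq> {}" shows "\<sigma> \<one> a = a"
proof -
  obtain u where "u \<in> C" using assms(2) by blast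
  then have "\<one> \<in> S" using \<phi>_one C_V by (intro SI[of _ u]) auto
  then have "\<sigma> \<one> (\<sigma> \<one> a) = \<sigma> \<one> a" "inj (\<sigma> \<one>)"
    using mult[OF assms(1), of \<one> \<one>] perm permutes_inj by auto
  then show ?thesis by (simp add: inj_def)
qed

lemma obtain_rep:
  assumes "v \<in> V" obtains \<gamma> where "\<gamma> \<in> carrier K" "\<phi> \<gamma> v \<in> F"
  using unique_rep[OF assms] by (auto simp: orbit_def)

lemma rep_unique:
  assumes "v \<in> V" "\<gamma> \<in> carrier K" "\<phi> \<gamma> v \<in> F" "\<gamma>' \<in> carrier K" "\<phi> \<gamma>' v \<in> F"
  shows "\<phi> \<gamma>' v = \<phi> \<gamma> v"
proof -
  have "\<phi> \<gamma> v \<in> F \<inter> orbit K \<phi> v" "\<phi> \<gamma>' v \<in> F \<inter> orbit K \<phi> v"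
    using assms(2-) unfolding orbit_def by blast+
  then show ?thesis using unique_rep[OF assms(1)] by blast
qed

text \<open>A common point \<open>(\<sigma> s a, s v) = (\<sigma> t a', t v')\<close> gives \<open>\<delta> = inv t \<otimes> s\<close> with \<open>\<delta> v = v'\<close> and
  \<open>a' = \<sigma> \<delta> a\<close>. As \<open>\<delta>\<close> moves \<open>v \<in> C\<close> to \<open>v' \<in> C\<close>, it belongs to \<open>S\<close>, and so does every element
  that takes a point of \<open>C\<close> into \<open>F\<close>. Hence \<open>\<sigma> (\<beta> \<otimes> \<delta>) a = \<sigma> \<beta> a'\<close> for all \<open>\<beta>\<close> that contribute to
  \<open>cell a' w\<close>, and reindexing by \<open>\<zeta> = \<beta> \<otimes> \<delta>\<close> yields the other description of this cell. The point
  \<open>inv \<delta> w\<close> may lie outside \<open>C\<close>.\<close>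
lemma cell_meet:
  assumes "a \<in> A" "a' \<in> A" "v \<in> C" "v' \<in> C" "cell a v \<inter> cell a' v' \<noteq> {}"
  shows "\<exists>\<delta>\<in>carrier K. \<phi> \<delta> v = v' \<and> (\<forall>w\<in>C. cell a' w = cell a (\<phi> (inv \<delta>) w))"
proof -
  obtain s t where s: "s \<in> carrier K" "\<phi> s v \<in> F" and t: "t \<in> carrier K" "\<phi> t v' \<in> F"
    and eq: "\<sigma> s a = \<sigma> t a'" "\<phi> s v = \<phi> t v'"
    using assms(5) by (auto simp: cell_def)
  have st: "s \<in> S" "t \<in> S"
    using S_to_rep s t assms(3,4) by auto
  define \<delta> where "\<delta> = inv t \<otimes> s"
  have \<delta>: "\<delta> \<in> carrier K" using s t by (simp add: \<delta>_def)
  have V: "v \<in> V" "v' \<in> V" using assms C_V by auto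
  have "\<phi> \<delta> v = \<phi> (inv t) (\<phi> t v')"
    using s t V eq composition_rule by (simp add: \<delta>_def)
  also have "\<dots> = v'" using orbit_sym_aux t V by blast
  finally have \<delta>v: "\<phi> \<delta> v = v'" .
  have "\<delta> \<in> S" using SI[OF \<delta> assms(3)] \<delta>v assms(4) by simp
  have "inv t \<otimes> t = \<one>" using t by simp
  have "\<sigma> \<one> a' = \<sigma> (inv t) (\<sigma> t a')"
    using mult[OF assms(2) S_inv[OF st(2)] st(2)] t by simp
  also have "\<dots> = \<sigma> \<delta> a"
    using mult[OF assms(1) S_inv[OF st(2)] st(1)] eq by (simp add: \<delta>_def)
  finally have a': "a' = \<sigma> \<delta> a"
    using \<sigma>_one[OF assms(2)] assms(3) by auto
  have "cell a' w = cell a (\<phi> (inv \<delta>) w)" if "w \<in> C" for w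
  proof -
    have wV: "w \<in> V" using that C_V by blast
    let ?u = "\<phi> (inv \<delta>) w"
    have u: "?u \<in> V" "\<phi> \<delta> ?u = w"
      using element_image[OF inv_closed[OF \<delta>] wV refl] wV \<delta> orbit_sym_aux[of "inv \<delta>" w] by auto
    have step: "\<sigma> (\<beta> \<otimes> \<delta>) a = \<sigma> \<beta> a' \<and> \<phi> (\<beta> \<otimes> \<delta>) ?u = \<phi> \<beta> w"
      if "\<beta> \<in> carrier K" "\<phi> \<beta> w \<in> F" for \<beta>
    proof -
      have "\<beta> \<in> S" using S_to_rep that \<open>w \<in> C\<close> by blast
      then show ?thesis
        using mult[OF assms(1) _ \<open>\<delta> \<in> S\<close>] a' composition_rule[OF u(1) that(1) \<delta>] u(2) by simp
    qed
    show ?thesis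
    proof (intro equalityI subsetI)
      fix z assume "z \<in> cell a' w"
      then obtain \<beta> where \<beta>: "\<beta> \<in> carrier K" "\<phi> \<beta> w \<in> F" "z = (\<sigma> \<beta> a', \<phi> \<beta> w)"
        by (auto simp: cell_def)
      then show "z \<in> cell a ?u"
        using step[OF \<beta>(1,2)] \<delta> unfolding cell_def
        by (intro CollectI exI[of _ "\<beta> \<otimes> \<delta>"]) simp
    next
      fix z assume "z \<in> cell a ?u"
      then obtain \<zeta> where \<zeta>: "\<zeta> \<in> carrier K" "\<phi> \<zeta> ?u \<in> F" "z = (\<sigma> \<zeta> a, \<phi> \<zeta> ?u)"
        by (auto simp: cell_def)
      define \<beta> where "\<beta> = \<zeta> \<otimes> inv \<delta>"
      have \<beta>: "\<beta> \<in> carrier K" "\<beta> \<otimes> \<delta> = \<zeta>"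
        using \<zeta> \<delta> by (auto simp: \<beta>_def m_assoc)
      have "\<phi> \<beta> w = \<phi> \<zeta> ?u"
        using composition_rule[OF u(1) \<beta>(1) \<delta>] \<beta>(2) u(2) by simp
      with \<zeta> \<beta> step[OF \<beta>(1)] show "z \<in> cell a' w"
        unfolding cell_def by (intro CollectI exI[of _ \<beta>]) simp
    qed
  qed
  with \<delta> \<delta>v show ?thesis by blast
qed

lemma cells_disjoint:
  assumes "a \<in> A" "a' \<in> A" "v \<in> C" "v' \<in> C" "cell a v \<noteq> cell a' v'"
  shows "cell a v \<inter> cell a' v' = {}"
proof (rule ccontr)
  assume "cell a v \<inter> cell a' v' \<noteq> {}"
  then obtain \<delta> where "\<delta> \<in> carrier K" "\<phi> \<delta> v = v'" "cell a' v' = cell a (\<phi> (inv \<delta>) v')"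
    using cell_meet[OF assms(1-4)] assms(4) by blast
  then show False
    using orbit_sym_aux[of \<delta> v v'] assms(3,5) C_V by auto
qed

text \<open>By freeness, the first component of a point of the cell determines the group element behind it.\<close>
lemma inj_on_cell:
  assumes "a \<in> A" shows "inj_on (cell a) C"
proof (rule inj_onI)
  fix v w assume vw: "v \<in> C" "w \<in> C" "cell a v = cell a w"
  obtain \<gamma> where \<gamma>: "\<gamma> \<in> carrier K" "\<phi> \<gamma> v \<in> F" using obtain_rep vw(1) C_V by blast
  then have "(\<sigma> \<gamma> a, \<phi> \<gamma> v) \<in> cell a v" by (auto simp: cell_def)
  then have "(\<sigma> \<gamma> a, \<phi> \<gamma> v) \<in> cell a w" using vw(3) by simp
  then obtain \<gamma>' where \<gamma>': "\<gamma>' \<in> carrier K" "\<phi> \<gamma>' w \<in> F" "\<sigma> \<gamma> a = \<sigma> \<gamma>' a" "\<phi> \<gamma> v = \<phi> \<gamma>' w"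
    by (auto simp: cell_def)
  have "\<gamma> = \<gamma>'"
    using free[OF assms] \<gamma>' S_to_rep[OF \<gamma>(1) vw(1) \<gamma>(2)] S_to_rep[OF \<gamma>'(1) vw(2) \<gamma>'(2)]
    by (auto simp: inj_on_def)
  then show "v = w"
    using \<gamma>'(4) inj_prop[OF \<gamma>(1)] vw C_V by (auto simp: inj_on_def)
qed

lemma cell_nonempty:
  assumes "v \<in> V" shows "cell a v \<noteq> {}"
proof -
  obtain \<gamma> where "\<gamma> \<in> carrier K" "\<phi> \<gamma> v \<in> F" using obtain_rep[OF assms] .
  then show ?thesis by (auto simp: cell_def)
qed

lemma cell_subset:
  assumes "a \<in> A" "v \<in> C" shows "cell a v \<subseteq> {1..n} \<times> (F \<inter> C)"
proof -
  have "\<sigma> \<gamma> a \<in> {1..n}" if "\<gamma> \<in> carrier K" "\<phi> \<gamma> v \<in> F" for \<gamma>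
    using permutes_in_image[OF perm[OF S_to_rep[OF that(1) assms(2) that(2)]], of a] A_n assms(1)
    by auto
  then show ?thesis using C_reps assms(2) by (auto simp: cell_def)
qed

text \<open>If \<open>\<gamma>\<close> takes \<open>v\<close> to its representative \<open>f\<close>, then the elements with this property are the \<open>\<beta> \<otimes> \<gamma>\<close>
  with \<open>\<beta>\<close> in the stabilizer of \<open>f\<close>, and by freeness they give different points of the cell.\<close>
lemma card_cell:
  assumes "a \<in> A" "v \<in> C" "z \<in> cell a v"
  shows "card (cell a v) = card (stabilizer K \<phi> (snd z))"
proof -
  obtain \<gamma> where \<gamma>: "\<gamma> \<in> carrier K" "\<phi> \<gamma> v \<in> F" "snd z = \<phi> \<gamma> v"
    using assms(3) by (auto simp: cell_def)
  let ?f = "\<phi> \<gamma> v"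
  have V: "v \<in> V" "?f \<in> V" using assms(2) C_V \<gamma> F_V by auto
  have stab: "\<beta> \<otimes> \<gamma> \<in> carrier K" "\<phi> (\<beta> \<otimes> \<gamma>) v = ?f" if "\<beta> \<in> stabilizer K \<phi> ?f" for \<beta>
    using that \<gamma> composition_rule[OF V(1)] by (auto simp: stabilizer_def)
  have "bij_betw (\<lambda>\<beta>. (\<sigma> (\<beta> \<otimes> \<gamma>) a, ?f)) (stabilizer K \<phi> ?f) (cell a v)"
    unfolding bij_betw_def
  proof
    show "inj_on (\<lambda>\<beta>. (\<sigma> (\<beta> \<otimes> \<gamma>) a, ?f)) (stabilizer K \<phi> ?f)"
    proof (rule inj_onI)
      fix x y assume xy: "x \<in> stabilizer K \<phi> ?f" "y \<in> stabilizer K \<phi> ?f"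
        "(\<sigma> (x \<otimes> \<gamma>) a, ?f) = (\<sigma> (y \<otimes> \<gamma>) a, ?f)"
      have "x \<otimes> \<gamma> \<in> S" "y \<otimes> \<gamma> \<in> S"
        using S_to_rep[OF stab(1) assms(2)] stab(2) xy(1,2) \<gamma>(2) by auto
      then have "x \<otimes> \<gamma> = y \<otimes> \<gamma>"
        using free[OF assms(1)] xy(3) by (auto simp: inj_on_def)
      then show "x = y" using xy \<gamma>(1) by (auto simp: stabilizer_def)
    qed
    show "(\<lambda>\<beta>. (\<sigma> (\<beta> \<otimes> \<gamma>) a, ?f)) ` stabilizer K \<phi> ?f = cell a v"
    proof (intro equalityI subsetI)
      fix y assume "y \<in> (\<lambda>\<beta>. (\<sigma> (\<beta> \<otimes> \<gamma>) a, ?f)) ` stabilizer K \<phi> ?f"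
      then obtain \<beta> where "\<beta> \<in> stabilizer K \<phi> ?f" "y = (\<sigma> (\<beta> \<otimes> \<gamma>) a, ?f)" by blast
      then show "y \<in> cell a v"
        using stab[of \<beta>] \<gamma>(2) unfolding cell_def by (intro CollectI exI[of _ "\<beta> \<otimes> \<gamma>"]) simp
    next
      fix y assume "y \<in> cell a v"
      then obtain \<zeta> where \<zeta>: "\<zeta> \<in> carrier K" "\<phi> \<zeta> v \<in> F" "y = (\<sigma> \<zeta> a, \<phi> \<zeta> v)"
        by (auto simp: cell_def)
      have f: "\<phi> \<zeta> v = ?f" using rep_unique[OF V(1) \<gamma>(1,2) \<zeta>(1,2)] .
      have "\<phi> (\<zeta> \<otimes> inv \<gamma>) ?f = \<phi> \<zeta> v"
        using composition_rule[OF V(2) \<zeta>(1), of "inv \<gamma>"] orbit_sym_aux[OF \<gamma>(1) V(1)] \<gamma>(1) by simp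
      then have "\<zeta> \<otimes> inv \<gamma> \<in> stabilizer K \<phi> ?f"
        using \<zeta>(1) \<gamma>(1) f by (simp add: stabilizer_def)
      moreover have "\<zeta> = (\<zeta> \<otimes> inv \<gamma>) \<otimes> \<gamma>" using \<zeta>(1) \<gamma>(1) by (simp add: m_assoc)
      ultimately show "y \<in> (\<lambda>\<beta>. (\<sigma> (\<beta> \<otimes> \<gamma>) a, ?f)) ` stabilizer K \<phi> ?f"
        using \<zeta>(3) f by (intro image_eqI[of _ _ "\<zeta> \<otimes> inv \<gamma>"]) auto
    qed
  qed
  then show ?thesis using bij_betw_same_card \<gamma>(3) by fastforce
qed

text \<open>The points of one cell have total weight 1, and different cells are disjoint.\<close>
lemma card_cells_eq_weight:
  assumes "finite C" "X \<subseteq> {cell a v | a v. a \<in> A \<and> v \<in> C}"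
  shows "real (card X) = (\<Sum>z\<in>\<Union>X. 1 / real (card (stabilizer K \<phi> (snd z))))"
proof -
  let ?w = "\<lambda>z. 1 / real (card (stabilizer K \<phi> (snd z)))"
  have fin: "finite x" if "x \<in> X" for x
  proof -
    have "x \<subseteq> {1..n} \<times> (F \<inter> C)" using that assms(2) cell_subset by blast
    then show ?thesis by (rule finite_subset) (use assms(1) in simp)
  qed
  have one: "sum ?w x = 1" if "x \<in> X" for x
  proof -
    obtain a v where av: "x = cell a v" "a \<in> A" "v \<in> C" using assms(2) \<open>x \<in> X\<close> by blast
    have "sum ?w x = (\<Sum>z\<in>x. 1 / real (card x))"
      using card_cell av by (intro sum.cong) auto
    moreover have "card x \<noteq> 0"
      using fin[OF that] cell_nonempty av C_V by auto
    ultimately show ?thesis by simp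
  qed
  have "\<forall>x\<in>X. \<forall>y\<in>X. x \<noteq> y \<longrightarrow> x \<inter> y = {}"
    using assms(2) cells_disjoint by blast
  then have "sum ?w (\<Union>X) = (sum \<circ> sum) ?w X"
    using fin by (intro sum.Union_disjoint) auto
  then show ?thesis using one by simp
qed

end

lemma (in quotient_cells) cells_compatible:
  assumes "simple_graph G" "verts G = V"
    and pres: "\<And>\<gamma> x y. \<gamma> \<in> carrier K \<Longrightarrow> {x, y} \<in> edges G \<Longrightarrow> {\<phi> \<gamma> x, \<phi> \<gamma> y} \<in> edges G"
    and W: "W \<union> (\<Union>v\<in>W. neighbours G v) \<subseteq> C"
    and e: "inj_on e {cell a v | a v. a \<in> A \<and> v \<in> C}"
  shows "compatible_charts G W A (\<lambda>a v. e (cell a v))"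
proof
  show "W \<subseteq> verts G" using W C_V assms(2) by blast
  fix a assume a: "a \<in> A"
  show "inj_on (\<lambda>v. e (cell a v)) (W \<union> (\<Union>v\<in>W. neighbours G v))"
  proof (rule inj_onI)
    fix v w assume vw: "v \<in> W \<union> (\<Union>v\<in>W. neighbours G v)" "w \<in> W \<union> (\<Union>v\<in>W. neighbours G v)"
      "e (cell a v) = e (cell a w)"
    then have C: "v \<in> C" "w \<in> C" using W by blast+
    have "cell a v = cell a w" by (rule inj_onD[OF e vw(3)]) (use C a in auto)
    then show "v = w" using inj_onD[OF inj_on_cell[OF a]] C by blast
  qed
next
  fix a a' v v' w'
  assume a: "a \<in> A" "a' \<in> A" and v: "v \<in> W" "v' \<in> W" "w' \<in> W"
    and eq: "e (cell a v) = e (cell a' v')" and edge: "{v', w'} \<in> edges G"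
  have C: "v \<in> C" "v' \<in> C" "w' \<in> C" using v W by auto
  have "cell a v = cell a' v'" by (rule inj_onD[OF e eq]) (use C a in auto)
  then have "cell a v \<inter> cell a' v' \<noteq> {}" using cell_nonempty C C_V by auto
  then obtain \<delta> where \<delta>: "\<delta> \<in> carrier K" "\<phi> \<delta> v = v'"
    "cell a' w' = cell a (\<phi> (inv \<delta>) w')"
    using cell_meet[OF a C(1,2)] C(3) by blast
  have "\<phi> (inv \<delta>) v' = v" using orbit_sym_aux[OF \<delta>(1) _ \<delta>(2)] C(1) C_V by blast
  then have "{v, \<phi> (inv \<delta>) w'} \<in> edges G"
    using pres[OF inv_closed[OF \<delta>(1)] edge] by simp
  then show "\<exists>w. {v, w} \<in> edges G \<and> e (cell a' w') = e (cell a w)"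
    using \<delta>(3) by (intro exI[of _ "\<phi> (inv \<delta>) w'"]) simp
qed (fact assms(1))

section \<open>Approximation by finite graphs\<close>

text \<open>A transporter that is not empty is a coset of the stabilizer.\<close>
lemma (in group_action) finite_transporter:
  assumes "u \<in> E" "finite (stabilizer G \<phi> u)"
  shows "finite {\<gamma> \<in> carrier G. \<phi> \<gamma> u = v}"
proof (cases "\<exists>\<gamma>\<in>carrier G. \<phi> \<gamma> u = v")
  case True
  interpret group G using group_hom by (rule group_hom.axioms)
  obtain \<beta> where \<beta>: "\<beta> \<in> carrier G" "\<phi> \<beta> u = v" using True by blast
  have "{\<gamma> \<in> carrier G. \<phi> \<gamma> u = v} \<subseteq> (\<lambda>s. \<beta> \<otimes> s) ` stabilizer G \<phi> u"
  proof
    fix \<gamma> assume "\<gamma> \<in> {\<gamma> \<in> carrier G. \<phi> \<gamma> u = v}"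
    then have \<gamma>: "\<gamma> \<in> carrier G" "\<phi> \<gamma> u = v" by auto
    have "\<phi> (inv \<beta> \<otimes> \<gamma>) u = u"
      using composition_rule[OF assms(1), of "inv \<beta>" \<gamma>] orbit_sym_aux[OF \<beta>(1) assms(1) \<beta>(2)] \<beta> \<gamma>
      by simp
    then have "inv \<beta> \<otimes> \<gamma> \<in> stabilizer G \<phi> u" using \<beta> \<gamma> by (simp add: stabilizer_def)
    moreover have "\<gamma> = \<beta> \<otimes> (inv \<beta> \<otimes> \<gamma>)" using \<beta>(1) \<gamma>(1) by (simp add: m_assoc[symmetric])
    ultimately show "\<gamma> \<in> (\<lambda>s. \<beta> \<otimes> s) ` stabilizer G \<phi> u" by (rule rev_image_eqI)
  qed
  then show ?thesis by (rule finite_subset) (use assms(2) in simp)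
next
  case False
  then have "{\<gamma> \<in> carrier G. \<phi> \<gamma> u = v} = {}" by blast
  then show ?thesis by (simp only: finite.emptyI)
qed

text \<open>A single finite set \<open>F0\<close> serves all subsets \<open>P\<close> at once: what is lost on \<open>P\<close> is at most the tail
  of the whole sum.\<close>
lemma nonneg_infsum_finite_lower:
  fixes w :: "'a \<Rightarrow> real"
  assumes "w summable_on F" "\<And>x. x \<in> F \<Longrightarrow> w x \<ge> 0" "\<eta> > 0"
  shows "\<exists>F0. finite F0 \<and> F0 \<subseteq> F \<and>
    (\<forall>F1 P. F0 \<subseteq> F1 \<longrightarrow> finite F1 \<longrightarrow> F1 \<subseteq> F \<longrightarrow> P \<subseteq> F \<longrightarrow> sum w (F1 \<inter> P) \<ge> infsum w P - \<eta>)"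
proof -
  obtain F0 where F0: "finite F0" "F0 \<subseteq> F" "dist (sum w F0) (infsum w F) \<le> \<eta>"
    using infsum_finite_approximation[OF assms(1,3)] by blast
  have "sum w (F1 \<inter> P) \<ge> infsum w P - \<eta>"
    if F1: "F0 \<subseteq> F1" "finite F1" "F1 \<subseteq> F" and P: "P \<subseteq> F" for F1 P
  proof -
    have sub: "w summable_on X" if "X \<subseteq> F" for X
      using summable_on_subset_banach[OF assms(1) that] .
    have "infsum w ((F1 \<inter> P) \<union> (P - F1)) = infsum w (F1 \<inter> P) + infsum w (P - F1)"
      using P by (intro infsum_Un_disjoint sub) auto
    moreover have "(F1 \<inter> P) \<union> (P - F1) = P" by blast
    moreover have "infsum w (P - F1) \<le> infsum w (F - F1)"
      using assms(2) P by (intro infsum_mono2 sub) auto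
    moreover have "infsum w (F1 \<union> (F - F1)) = infsum w F1 + infsum w (F - F1)"
      using F1(3) by (intro infsum_Un_disjoint sub) auto
    moreover have "F1 \<union> (F - F1) = F" using F1(3) by blast
    moreover have "sum w F0 \<le> sum w F1"
      using F1 assms(2) by (intro sum_mono2) auto
    moreover have "infsum w F - \<eta> \<le> sum w F0" using F0(3) by (simp add: dist_real_def)
    ultimately show ?thesis using F1(2) by simp
  qed
  with F0 show ?thesis by blast
qed

text \<open>The Boolean \<open>b\<close> selects either the vertices whose ball represents \<open>\<alpha>\<close> or the others. With
  both lower bounds, the upper bound on the number of all vertices becomes an upper bound for each
  kind.\<close>
lemma sofic_finite_approximation:
  fixes G :: "'v ugraph" and K (structure) and \<phi> and F :: "'v set" and \<kappa> :: real and R D :: nat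
  defines "w \<equiv> \<lambda>f. 1 / real (card (stabilizer K \<phi> f))"
  assumes action: "group_action K (verts G) \<phi>" and "sofic K"
    and pres: "\<And>\<gamma> x y. \<gamma> \<in> carrier K \<Longrightarrow> {x, y} \<in> edges G \<Longrightarrow> {\<phi> \<gamma> x, \<phi> \<gamma> y} \<in> edges G"
    and G: "simple_graph G" "degree_bounded D G"
    and stab: "\<And>x. x \<in> verts G \<Longrightarrow> finite (stabilizer K \<phi> x)"
    and F: "F \<subseteq> verts G" "F \<noteq> {}" "\<And>v. v \<in> verts G \<Longrightarrow> \<exists>!f. f \<in> F \<inter> orbit K \<phi> v"
      "w summable_on F"
    and "\<kappa> > 0"
  shows "\<exists>(H :: nat ugraph) n. n \<ge> 1 \<and> finite_graph H \<and> degree_bounded D H \<and>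
    real (card (verts H)) \<le> real n * infsum w F \<and>
    (\<forall>r\<le>R. \<forall>\<alpha> b. real n * (infsum w {f \<in> F. represents (gball G r f) \<alpha> = b} - \<kappa>)
      \<le> real (card {x \<in> verts H. represents (gball H r x) \<alpha> = b}))"
proof -
  interpret group_action K "verts G" \<phi> by (fact action)
  interpret group K using group_hom by (rule group_hom.axioms)
  define M where "M = infsum w F"
  have w: "w x \<ge> 0" for x by (simp add: w_def)
  obtain f0 where f0: "f0 \<in> F" using F(2) by blast
  have "\<one> \<in> stabilizer K \<phi> f0" using stabilizer_one_closed f0 F(1) by blast
  then have "card (stabilizer K \<phi> f0) > 0" using stab f0 F(1) by (auto simp: card_gt_0_iff)
  then have "w f0 > 0" by (simp add: w_def)
  moreover have "sum w {f0} \<le> M"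
    unfolding M_def using f0 F(4) w by (intro finite_sum_le_infsum) auto
  ultimately have "M > 0" by simp
  have "\<kappa> / 2 > 0" using \<open>\<kappa> > 0\<close> by simp
  obtain F0 where F0: "finite F0" "F0 \<subseteq> F"
    "\<And>F1 P. F0 \<subseteq> F1 \<Longrightarrow> finite F1 \<Longrightarrow> F1 \<subseteq> F \<Longrightarrow> P \<subseteq> F \<Longrightarrow> sum w (F1 \<inter> P) \<ge> infsum w P - \<kappa> / 2"
    using nonneg_infsum_finite_lower[OF F(4) w \<open>\<kappa> / 2 > 0\<close>] by blast
  \<comment> \<open>Adding \<open>f0\<close> ensures that the finite graph has a vertex.\<close>
  define F1 where "F1 = insert f0 F0"
  have F1: "finite F1" "F1 \<subseteq> F" "f0 \<in> F1" using F0 f0 by (auto simp: F1_def)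
  have sum_F1: "sum w (F1 \<inter> P) \<ge> infsum w P - \<kappa> / 2" if "P \<subseteq> F" for P
    using F0(3)[of F1 P] F1 that by (auto simp: F1_def)
  \<comment> \<open>Half of \<open>\<kappa>\<close> pays for the orbits outside \<open>F1\<close>, the other half for the points that are not good.
    The bound \<open>1 / 2\<close> leaves at least one good point.\<close>
  define \<epsilon> where "\<epsilon> = min (1 / 2) (\<kappa> / (2 * M))"
  have \<epsilon>: "\<epsilon> > 0" "\<epsilon> < 1" "\<epsilon> * M \<le> \<kappa> / 2"
  proof -
    have "\<epsilon> * M \<le> \<kappa> / (2 * M) * M"
      using \<open>M > 0\<close> unfolding \<epsilon>_def by (intro mult_right_mono) auto
    also have "\<dots> = \<kappa> / 2" using \<open>M > 0\<close> by simp
    finally show "\<epsilon> * M \<le> \<kappa> / 2" .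
  qed (use \<open>\<kappa> > 0\<close> \<open>M > 0\<close> in \<open>auto simp: \<epsilon>_def\<close>)
  define W where "W = (\<Union>f\<in>F1. {y \<in> verts G. gdist G f y \<le> enat R})"
  have "finite W"
    unfolding W_def using F1 F(1) finite_distance_ball[OF G] by auto
  have "W \<subseteq> verts G" by (auto simp: W_def)
  have gdist_refl: "gdist G f f \<le> enat R" for f by (auto simp: gdist_le_iff intro!: exI[of _ 0])
  then have "F1 \<subseteq> W" using F1 F(1) by (auto simp: W_def)
  define U where "U = W \<union> (\<Union>v\<in>W. neighbours G v)"
  have "finite U"
    using \<open>finite W\<close> \<open>W \<subseteq> verts G\<close> G(2) by (auto simp: U_def degree_bounded_def)
  have "U \<subseteq> verts G"
    using \<open>W \<subseteq> verts G\<close> simple_graph_edge_in_verts[OF G(1)] by (auto simp: U_def neighbours_def)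
  define C where "C = U \<union> (\<Union>u\<in>U. F \<inter> orbit K \<phi> u)"
  have "finite (F \<inter> orbit K \<phi> u)" if "u \<in> U" for u
  proof -
    have "\<exists>!f. f \<in> F \<inter> orbit K \<phi> u" using F(3) that \<open>U \<subseteq> verts G\<close> by blast
    then obtain f where "F \<inter> orbit K \<phi> u = {f}" by blast
    then show ?thesis by simp
  qed
  then have "finite C"
    unfolding C_def using \<open>finite U\<close> by (intro finite_UnI finite_UN_I)
  have "C \<subseteq> verts G" using \<open>U \<subseteq> verts G\<close> F(1) by (auto simp: C_def)
  have C_reps: "\<phi> \<gamma> u \<in> C" if u: "u \<in> C" "\<gamma> \<in> carrier K" "\<phi> \<gamma> u \<in> F" for u \<gamma>
  proof -
    obtain v where v: "v \<in> U" "u \<in> orbit K \<phi> v"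
      using u(1) orbit_refl \<open>U \<subseteq> verts G\<close> unfolding C_def by blast
    have "\<phi> \<gamma> u \<in> orbit K \<phi> u" using u(2) by (auto simp: orbit_def)
    then have "\<phi> \<gamma> u \<in> orbit K \<phi> v"
      using orbit_trans[of v u "\<phi> \<gamma> u"] v u \<open>U \<subseteq> verts G\<close> \<open>C \<subseteq> verts G\<close> F(1) by blast
    then show ?thesis using v(1) u(3) by (auto simp: C_def)
  qed
  define S where "S = {\<gamma> \<in> carrier K. \<exists>u\<in>C. \<phi> \<gamma> u \<in> C}"
  have "S \<subseteq> (\<Union>u\<in>C. \<Union>v\<in>C. {\<gamma> \<in> carrier K. \<phi> \<gamma> u = v})" by (auto simp: S_def)
  moreover have "finite \<dots>"
    using \<open>finite C\<close> finite_transporter stab \<open>C \<subseteq> verts G\<close> by (intro finite_UN_I) auto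
  ultimately have "finite S" by (rule finite_subset)
  have "S \<subseteq> carrier K" by (auto simp: S_def)
  obtain n \<sigma> A where n: "n \<ge> 1" and perm: "\<forall>s\<in>S. \<sigma> s permutes {1..n}" and A: "A \<subseteq> {1..n}"
    "real (card A) \<ge> (1 - \<epsilon>) * real n"
    and mult: "\<forall>a\<in>A. \<forall>s\<in>S. \<forall>t\<in>S. \<sigma> s (\<sigma> t a) = \<sigma> (s \<otimes> t) a"
    and free: "\<forall>a\<in>A. inj_on (\<lambda>s. \<sigma> s a) S"
    using sofic_good_points[OF \<open>sofic K\<close> \<open>finite S\<close> \<open>S \<subseteq> carrier K\<close> \<epsilon>(1)] by blast
  interpret quotient_cells K "verts G" \<phi> F C S \<sigma> n A
    using F(1,3) \<open>C \<subseteq> verts G\<close> C_reps A(1) perm mult free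
    by unfold_locales (auto simp: S_def)
  \<comment> \<open>The cells are renamed to natural numbers to obtain a graph of the required type.\<close>
  define Cells where "Cells = {cell a v | a v. a \<in> A \<and> v \<in> C}"
  have "finite A" using A(1) finite_subset by blast
  have "Cells = (\<lambda>(a, v). cell a v) ` (A \<times> C)" by (auto simp: Cells_def)
  then have "finite Cells" using \<open>finite A\<close> \<open>finite C\<close> by simp
  from finite_imp_inj_to_nat_seg[OF this]
  obtain e :: "(nat \<times> 'v) set \<Rightarrow> nat" where e: "inj_on e Cells" by auto
  have "W \<union> (\<Union>v\<in>W. neighbours G v) \<subseteq> C" by (auto simp: C_def U_def)
  then interpret compatible_charts G W A "\<lambda>a v. e (cell a v)"
    using cells_compatible[OF G(1) refl pres] e by (simp add: Cells_def)
  have "W \<subseteq> C" by (auto simp: C_def U_def)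
  \<comment> \<open>\<open>X F1\<close> consists of the vertices whose balls are under control; the vertex set is \<open>X W\<close>.\<close>
  define X where "X P = {cell a v | a v. a \<in> A \<and> v \<in> P}" for P
  have X_Cells: "X P \<subseteq> Cells" if "P \<subseteq> C" for P using that by (auto simp: X_def Cells_def)
  have verts_H: "verts H = e ` X W" by (auto simp: patch_graph_def X_def)
  have card_eX: "real (card (e ` X P)) = (\<Sum>z\<in>\<Union>(X P). w (snd z))" if "P \<subseteq> C" for P
  proof -
    have "card (e ` X P) = card (X P)"
      using e X_Cells[OF that] by (meson card_image inj_on_subset)
    then show ?thesis
      using card_cells_eq_weight[OF \<open>finite C\<close>, of "X P"] X_Cells[OF that]
      by (simp add: Cells_def w_def)
  qed
  have finite_union: "\<Union>(X P) \<subseteq> {1..n} \<times> (F \<inter> C)" if "P \<subseteq> C" for P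
    using cell_subset that unfolding X_def by blast
  have sum_times: "(\<Sum>z\<in>B \<times> P. w (snd z)) = real (card B) * sum w P" for B :: "nat set" and P
    by (simp add: sum.cartesian_product')
  have upper: "real (card (verts H)) \<le> real n * infsum w F"
  proof -
    have "real (card (verts H)) \<le> (\<Sum>z\<in>{1..n} \<times> (F \<inter> C). w (snd z))"
      unfolding verts_H card_eX[OF \<open>W \<subseteq> C\<close>]
      using finite_union[OF \<open>W \<subseteq> C\<close>] \<open>finite C\<close> w by (intro sum_mono2) auto
    also have "\<dots> = real n * sum w (F \<inter> C)" by (simp add: sum_times)
    also have "\<dots> \<le> real n * infsum w F"
      using F(4) \<open>finite C\<close> w by (intro mult_left_mono finite_sum_le_infsum) auto
    finally show ?thesis .
  qed
  have lower: "real n * (infsum w {f \<in> F. represents (gball G r f) \<alpha> = b} - \<kappa>)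
      \<le> real (card {x \<in> verts H. represents (gball H r x) \<alpha> = b})" if "r \<le> R" for r \<alpha> b
  proof -
    define Q where "Q = {f \<in> F. represents (gball G r f) \<alpha> = b}"
    define P where "P = F1 \<inter> Q"
    have P: "P \<subseteq> F1" "P \<subseteq> F" "P \<subseteq> W" "P \<subseteq> C" "finite P"
      using F1 \<open>F1 \<subseteq> W\<close> \<open>W \<subseteq> C\<close> by (auto simp: P_def)
    have "e ` X P \<subseteq> {x \<in> verts H. represents (gball H r x) \<alpha> = b}"
    proof
      fix x assume "x \<in> e ` X P"
      then obtain a f where x: "x = e (cell a f)" "a \<in> A" "f \<in> P" by (auto simp: X_def)
      have "gdist G f y \<le> enat R" if "gdist G f y \<le> enat r" for y
        using that \<open>r \<le> R\<close> by (meson enat_ord_simps(1) order_trans)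
      then have "{y \<in> verts G. gdist G f y \<le> enat r} \<subseteq> W"
        using x(3) P(1) by (auto simp: W_def)
      moreover have "f \<in> verts G" using x(3) P(2) F(1) by blast
      ultimately have "represents (gball H r x) \<alpha> \<longleftrightarrow> represents (gball G r f) \<alpha>"
        using represents_gball_patch_graph[OF x(2)] x(1) by simp
      moreover have "x \<in> verts H" unfolding verts_H using x P(3) by (auto simp: X_def)
      ultimately show "x \<in> {x \<in> verts H. represents (gball H r x) \<alpha> = b}"
        using x(3) by (simp add: P_def Q_def)
    qed
    moreover have "finite (verts H)"
      unfolding verts_H using X_Cells[OF \<open>W \<subseteq> C\<close>] \<open>finite Cells\<close> by (meson finite_imageI finite_subset)
    ultimately have "card (e ` X P) \<le> card {x \<in> verts H. represents (gball H r x) \<alpha> = b}"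
      by (intro card_mono) auto
    moreover have "real (card (e ` X P)) \<ge> real (card A) * sum w P"
    proof -
      have "(a, f) \<in> \<Union>(X P)" if "a \<in> A" "f \<in> P" for a f
      proof -
        have "\<sigma> \<one> a = a" using \<sigma>_one[OF that(1)] that(2) P(4) by blast
        moreover have "\<phi> \<one> f = f" using \<phi>_one that(2) P(2) F(1) by blast
        ultimately have "(a, f) \<in> cell a f"
          using that(2) P(2) unfolding cell_def by (intro CollectI exI[of _ \<one>]) auto
        then show ?thesis using that by (auto simp: X_def)
      qed
      moreover have "finite (\<Union>(X P))"
        using finite_union[OF P(4)] by (rule finite_subset) (use \<open>finite C\<close> in simp)
      ultimately have "(\<Sum>z\<in>A \<times> P. w (snd z)) \<le> (\<Sum>z\<in>\<Union>(X P). w (snd z))"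
        using w by (intro sum_mono2) auto
      then show ?thesis using card_eX[OF P(4)] by (simp add: sum_times)
    qed
    moreover have "real (card A) * sum w P \<ge> real n * (infsum w Q - \<kappa>)"
    proof -
      have "sum w P \<le> M"
        unfolding M_def using F(4) P w by (intro finite_sum_le_infsum) auto
      then have "\<epsilon> * sum w P \<le> \<kappa> / 2"
        using \<epsilon> by (meson mult_left_mono order_trans less_imp_le)
      moreover have "sum w P \<ge> infsum w Q - \<kappa> / 2"
        unfolding P_def by (rule sum_F1) (auto simp: Q_def)
      ultimately have "infsum w Q - \<kappa> \<le> (1 - \<epsilon>) * sum w P"
        by (simp add: algebra_simps)
      then have "real n * (infsum w Q - \<kappa>) \<le> real n * ((1 - \<epsilon>) * sum w P)"
        by (intro mult_left_mono) auto
      also have "\<dots> = ((1 - \<epsilon>) * real n) * sum w P" by simp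
      also have "\<dots> \<le> real (card A) * sum w P"
        using A(2) w by (intro mult_right_mono sum_nonneg) auto
      finally show ?thesis .
    qed
    ultimately show ?thesis unfolding Q_def by linarith
  qed
  have "real (card A) > 0" using A(2) n \<epsilon>(2) by (smt (verit) mult_pos_pos of_nat_1 of_nat_mono)
  then obtain a where "a \<in> A" by fastforce
  then have "verts H \<noteq> {}" using \<open>F1 \<subseteq> W\<close> F1(3) by (auto simp: patch_graph_def)
  moreover have "finite (verts H)"
    unfolding verts_H using X_Cells[OF \<open>W \<subseteq> C\<close>] \<open>finite Cells\<close> by (meson finite_imageI finite_subset)
  ultimately have "finite_graph H" using simple_patch_graph by (simp add: finite_graph_def)
  with n degree_bounded_patch_graph[OF G(2)] upper lower show ?thesis by blast
qed

section \<open>Convergence of the frequencies\<close>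

text \<open>Let \<open>c b k\<close> be the number of vertices of kind \<open>b\<close> divided by \<open>N k\<close>. Both \<open>c True k\<close> and
  \<open>c False k\<close> are asymptotically bounded below by \<open>m True\<close> and \<open>m False\<close>, while their sum is bounded
  above by \<open>m True + m False\<close>; hence both converge. As the graphs have vertices, the upper bound also
  shows that \<open>m True + m False\<close> is positive.\<close>
lemma frequency_tendsto:
  fixes H :: "nat \<Rightarrow> 'a ugraph" and N :: "nat \<Rightarrow> nat" and m :: "bool \<Rightarrow> real"
  assumes fin: "\<And>k. finite_graph (H k)" and N: "\<And>k. N k \<ge> 1"
    and upper: "\<And>k. real (card (verts (H k))) \<le> real (N k) * (m True + m False)"
    and lower: "\<And>k b. k \<ge> k0 \<Longrightarrow> real (N k) * (m b - 1 / real (Suc k))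
      \<le> real (card {x \<in> verts (H k). represents (gball (H k) (class_radius \<alpha>) x) \<alpha> = b})"
  shows "(\<lambda>k. frequency (H k) \<alpha>) \<longlonglongrightarrow> m True / (m True + m False)"
proof -
  define c where "c b k =
    real (card {x \<in> verts (H k). represents (gball (H k) (class_radius \<alpha>) x) \<alpha> = b}) / real (N k)"
    for b k
  have N0: "real (N k) > 0" for k using N[of k] by simp
  have split: "real (card (verts (H k))) = real (N k) * (c True k + c False k)" for k
  proof -
    let ?T = "\<lambda>b. {x \<in> verts (H k). represents (gball (H k) (class_radius \<alpha>) x) \<alpha> = b}"
    have "finite (verts (H k))" using fin[of k] by (simp add: finite_graph_def)
    then have "card (?T True \<union> ?T False) = card (?T True) + card (?T False)"
      by (intro card_Un_disjoint) auto
    moreover have "?T True \<union> ?T False = verts (H k)" by auto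
    ultimately have "card (verts (H k)) = card (?T True) + card (?T False)" by simp
    then show ?thesis using N0[of k] by (simp add: c_def field_simps)
  qed
  have c_upper: "c True k + c False k \<le> m True + m False" for k
    using upper[of k] N0[of k] unfolding split by (simp add: mult_le_cancel_left_pos)
  have c_lower: "m b - 1 / real (Suc k) \<le> c b k" if "k \<ge> k0" for b k
    using lower[OF that, of b] N0[of k] unfolding c_def by (simp add: field_simps)
  have lim0: "(\<lambda>k. 1 / real (Suc k)) \<longlonglongrightarrow> 0" by (rule lim_1_over_n[THEN LIMSEQ_Suc])
  have lim: "c b \<longlonglongrightarrow> m b" for b
  proof (rule tendsto_sandwich)
    show "\<forall>\<^sub>F k in sequentially. m b - 1 / real (Suc k) \<le> c b k"
      using eventually_ge_at_top[of k0] by eventually_elim (rule c_lower)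
    show "\<forall>\<^sub>F k in sequentially. c b k \<le> m b + 1 / real (Suc k)"
      using eventually_ge_at_top[of k0]
    proof eventually_elim
      case (elim k)
      then show ?case
        using c_upper[of k] c_lower[of k True] c_lower[of k False] by (cases b) auto
    qed
  qed (use tendsto_diff[OF tendsto_const lim0, of "m b"] tendsto_add[OF tendsto_const lim0, of "m b"]
        in simp_all)
  have "real (card (verts (H 0))) > 0"
    using fin[of 0] by (simp add: finite_graph_def card_gt_0_iff)
  then have "c True 0 + c False 0 > 0"
    using N0[of 0] unfolding split by (simp add: zero_less_mult_iff)
  then have "m True + m False \<noteq> 0" using c_upper[of 0] by simp
  moreover have "frequency (H k) \<alpha> = c True k / (c True k + c False k)" for k
    using N0[of k] unfolding frequency_def split by (simp add: c_def)
  ultimately show ?thesis using lim by (auto intro!: tendsto_intros)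
qed

theorem theorem6p3:
  fixes G :: "'v ugraph" and \<Gamma> :: "('v \<Rightarrow> 'v) set" and F :: "'v set" and D :: nat
  assumes "periodic_graph G \<Gamma>"
    and "sofic (sub_aut_group G \<Gamma>)"
    and "degree_bounded D G"
    and "fundamental_domain G \<Gamma> F"
  shows "\<exists>Gs :: nat \<Rightarrow> nat ugraph. weakly_convergent D Gs \<and>
    (\<forall>\<alpha>\<in>iso_classes D.
      (\<lambda>n. frequency (Gs n) \<alpha>) \<longlonglongrightarrow>
        (\<Sum>\<^sub>\<infinity>f\<in>{f \<in> F. represents (gball G (class_radius \<alpha>) f) \<alpha>}. 1 / real (card (stab G \<Gamma> f)))
        / (\<Sum>\<^sub>\<infinity>f\<in>F. 1 / real (card (stab G \<Gamma> f))))"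
proof -
  let ?K = "sub_aut_group G \<Gamma>" and ?w = "\<lambda>f. 1 / real (card (stab G \<Gamma> f))"
  have per: "simple_graph G" "connected_graph G" "subgroup \<Gamma> (aut_group G)"
    "\<forall>x\<in>verts G. finite (stab G \<Gamma> x)"
    using assms(1) by (auto simp: periodic_graph_def)
  have fd: "F \<subseteq> verts G" "\<forall>X\<in>orbits ?K (verts G) (\<lambda>\<gamma>. \<gamma>). \<exists>!f. f \<in> F \<inter> X" "?w summable_on F"
    using assms(4) by (auto simp: fundamental_domain_def)
  have rep: "\<exists>!f. f \<in> F \<inter> orbit ?K (\<lambda>\<gamma>. \<gamma>) v" if "v \<in> verts G" for v
    using fd(2) that unfolding orbits_def by blast
  have "F \<noteq> {}"
    using per(2) rep by (auto simp: connected_graph_def)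
  have sub: "\<Gamma> \<subseteq> carrier (aut_group G)" using per(3) by (rule subgroup.subset)
  then have Bij: "\<Gamma> \<subseteq> Bij (verts G)" by (auto simp: aut_group_def)
  have "group ?K" using assms(2) by (simp add: sofic_def)
  moreover have "(\<lambda>\<gamma>. \<gamma>) \<in> hom ?K (BijGroup (verts G))"
    using Bij by (auto simp: hom_def aut_group_def BijGroup_def)
  ultimately have action: "group_action ?K (verts G) (\<lambda>\<gamma>. \<gamma>)"
    by (simp add: group_action_def group_hom_def group_hom_axioms_def group_BijGroup)
  have pres: "{\<gamma> x, \<gamma> y} \<in> edges G" if "\<gamma> \<in> carrier ?K" "{x, y} \<in> edges G" for \<gamma> x y
    using that sub simple_graph_edge_in_verts[OF per(1) that(2)] by (auto simp: aut_group_def)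
  \<comment> \<open>The \<open>k\<close>-th graph controls balls of radius up to \<open>k\<close> with error \<open>1 / (k + 1)\<close>; each class is
    covered from its radius on.\<close>
  define good where "good k H n \<longleftrightarrow> n \<ge> 1 \<and> finite_graph H \<and> degree_bounded D H \<and>
    real (card (verts H)) \<le> real n * infsum ?w F \<and>
    (\<forall>r\<le>k. \<forall>\<alpha> b. real n * (infsum ?w {f \<in> F. represents (gball G r f) \<alpha> = b} - 1 / real (Suc k))
      \<le> real (card {x \<in> verts H. represents (gball H r x) \<alpha> = b}))"
    for k n :: nat and H :: "nat ugraph"
  have "\<exists>H n. good k H n" for k
    unfolding good_def
    by (rule sofic_finite_approximation[where \<phi> = "\<lambda>\<gamma>. \<gamma>", OF action assms(2) _ per(1) assms(3)],
        (rule pres; assumption))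
      (use per(4) fd(1,3) rep \<open>F \<noteq> {}\<close> in auto)
  then obtain Gs N where Gs: "\<And>k. good k (Gs k) (N k)" by metis
  have lim: "(\<lambda>k. frequency (Gs k) \<alpha>) \<longlonglongrightarrow>
      infsum ?w {f \<in> F. represents (gball G (class_radius \<alpha>) f) \<alpha>} / infsum ?w F" for \<alpha>
  proof -
    define Q where "Q b = {f \<in> F. represents (gball G (class_radius \<alpha>) f) \<alpha> = b}" for b
    define m where "m b = infsum ?w (Q b)" for b
    have summable: "?w summable_on Q b" for b
      using fd(3) by (rule summable_on_subset_banach) (auto simp: Q_def)
    have "Q True \<inter> Q False = {}" by (auto simp: Q_def)
    then have "infsum ?w (Q True \<union> Q False) = m True + m False"
      unfolding m_def by (rule infsum_Un_disjoint[OF summable summable])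
    moreover have "Q True \<union> Q False = F" by (auto simp: Q_def)
    ultimately have total: "infsum ?w F = m True + m False" by simp
    have "(\<lambda>k. frequency (Gs k) \<alpha>) \<longlonglongrightarrow> m True / (m True + m False)"
    proof (rule frequency_tendsto[where N = N and ?k0.0 = "class_radius \<alpha>"])
      show "finite_graph (Gs k)" "N k \<ge> 1"
        "real (card (verts (Gs k))) \<le> real (N k) * (m True + m False)" for k
        using Gs[of k] by (simp_all add: good_def total)
      show "real (N k) * (m b - 1 / real (Suc k)) \<le>
          real (card {x \<in> verts (Gs k). represents (gball (Gs k) (class_radius \<alpha>) x) \<alpha> = b})"
        if "class_radius \<alpha> \<le> k" for k b
        using Gs[of k] that unfolding good_def m_def Q_def by blast
    qed
    then show ?thesis using total by (simp add: m_def Q_def)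
  qed
  have "weakly_convergent D Gs"
    unfolding weakly_convergent_def using Gs convergentI[OF lim] by (simp add: good_def)
  with lim show ?thesis by blast
qed

end
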